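(* For every integer $k\geq 3$ there is a constant $C_k>0$, depending only on $k$, such that the following holds for every nonzero integer $n$. Assume that $a_0$ is a positive integer and $a_1,a_2,\ldots,a_d$ are distinct positive integers such that $H^\times(a_0;a_1,a_2,\ldots,a_d)\subseteq\{x^k-n: x\in\mathbb{N}\}$. Then $$d\leq C_k\sqrt{\log(|n|+1)}.$$
   Context: $\mathbb{N}$ is the set of positive integers. For a positive integer $a_0$ and distinct positive integers $a_1,\ldots,a_d$, the multiplicative Hilbert cube is $$H^\times(a_0;a_1,\ldots,a_d)=\Big\{a_0\prod_{i\in I}a_i: I\subseteq\{1,2,\ldots,d\}\Big\},$$ where the empty product equals $1$. *)

theory Defs
  imports Complex_Main
begin

(* H(a0; a 1, ..., a d). Only the values of a on {1..d} matter. *)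
definition mult_hilbert_cube :: "nat \<Rightarrow> (nat \<Rightarrow> nat) \<Rightarrow> nat \<Rightarrow> nat set" where
  "mult_hilbert_cube a0 a d = {a0 * (\<Prod>i\<in>I. a i) | I. I \<subseteq> {1..d}}"

(* The values x^k - n may be negative or zero, so they are taken in the integers;
   x ranges over the positive integers. *)
definition shifted_powers :: "nat \<Rightarrow> int \<Rightarrow> int set" where
  "shifted_powers k n = {int x ^ k - n | x :: nat. x > 0}"

end

theory Submission
  imports Defs "HOL-Analysis.Generalised_Binomial_Theorem"
begin

text \<open>
  Split the generators of the cube into two halves, and let \<open>A\<close> and \<open>B\<close> be the sets of subset products of
  the two halves, with \<open>a0\<close> included in \<open>A\<close>. Then \<open>(a * b + n) powr (1 / k)\<close> is an integer for all
  \<open>a \<in> A\<close>, \<open>b \<in> B\<close>, and two properties of this integer matrix pull in opposite directions.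

  On the one hand it is nonsingular: a nontrivial real combination of \<open>m\<close> functions
  \<open>x \<mapsto> (n + b * x) powr (1 / k)\<close> has fewer than \<open>m\<close> zeros
  (\<open>card_zeros_powr_sum_less\<close>, by Rolle's theorem). On the other hand, if \<open>a * b\<close> stays
  away from \<open>\<bar>n\<bar>\<close> by a factor \<open>2\<close>, the binomial series converges geometrically, so with entries up to \<open>N\<close>
  the matrix is indistinguishable from one of rank \<open>O(log N)\<close>. The pigeonhole principle
  (\<open>small_integer_combination\<close>) then gives a short integer relation between the columns that holds up to
  an error less than \<open>1\<close>, hence exactly. Together these bound the smaller side of the grid by
  \<open>O(log N)\<close> (\<open>integral_power_grid_small\<close>, \<open>kth_power_grid_small\<close>). The distance from \<open>\<bar>n\<bar>\<close> is
  arranged by halving each side at its median and, where needed, multiplying \<open>A\<close> by one generator that was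
  kept in reserve (\<open>subgrid_away_from\<close>).

  Distinct integers \<open>\<ge> 2\<close> have quadratically many subset products (\<open>card_subset_products\<close>), so \<open>d\<^sup>2\<close> is
  bounded by \<open>O(log N)\<close>, where \<open>N\<close> bounds the elements of the cube. It remains to see that \<open>N\<close> is at most
  a fixed power of \<open>\<bar>n\<bar>\<close>. This is the gap principle (\<open>gap_principle\<close>, \<open>cube_product_le\<close>), applied to the
  two smallest generators other than \<open>1\<close>, and the place where \<open>k \<ge> 3\<close> enters.
\<close>

section \<open>Zeros of sums of powers of affine functions\<close>

text \<open>
  Rolle's theorem between consecutive elements of \<open>Z\<close>. The induction adds the elements in increasing
  order, so the invariant behind it keeps the zeros of \<open>h'\<close> below \<open>Max Z\<close>; this separates the next
  zero, which lies above \<open>Max Z\<close>, from the earlier ones.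
\<close>

lemma Rolle_count:
  fixes h h' :: "real \<Rightarrow> real"
  assumes "finite Z" "Z \<noteq> {}" "Z \<subseteq> S" "is_interval S"
    and "\<And>z. z \<in> Z \<Longrightarrow> h z = 0"
    and deriv: "\<And>x. x \<in> S \<Longrightarrow> (h has_real_derivative h' x) (at x)"
  obtains Z' where "finite Z'" "Z' \<subseteq> S" "card Z = Suc (card Z')" "\<And>z. z \<in> Z' \<Longrightarrow> h' z = 0"
proof -
  have "\<exists>Z'. finite Z' \<and> Z' \<subseteq> S \<and> card Z = Suc (card Z') \<and> (\<forall>z\<in>Z'. h' z = 0 \<and> z < Max Z)"
    using assms(1,2,3,5)
  proof (induction Z rule: finite_linorder_max_induct)
    case empty
    then show ?case by simp
  next
    case (insert b A)
    show ?case
    proof (cases "A = {}")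
      case True
      then show ?thesis by (intro exI[of _ "{}"]) auto
    next
      case False
      then have "\<exists>Z'. finite Z' \<and> Z' \<subseteq> S \<and> card A = Suc (card Z') \<and> (\<forall>z\<in>Z'. h' z = 0 \<and> z < Max A)"
        using insert.prems by (intro insert.IH) auto
      then obtain Z' where Z': "finite Z'" "Z' \<subseteq> S" "card A = Suc (card Z')"
        "\<And>z. z \<in> Z' \<Longrightarrow> h' z = 0 \<and> z < Max A"
        by blast
      define a where "a = Max A"
      have a: "a \<in> A" "a < b"
        using False insert.hyps by (auto simp: a_def)
      have S: "x \<in> S" if "a \<le> x" "x \<le> b" for x
        using that a insert.prems \<open>is_interval S\<close> unfolding is_interval_1 by blast
      have "continuous_on {a..b} h"
        using S deriv by (intro DERIV_continuous_on) (auto intro: has_field_derivative_at_within)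
      moreover have "(h has_derivative (\<lambda>y. h' x * y)) (at x)" if "a < x" "x < b" for x
        using deriv[of x] S[of x] that by (simp add: has_field_derivative_def)
      moreover have "h a = h b"
        using a insert.prems by simp
      ultimately obtain z where z: "a < z" "z < b" "(\<lambda>y. h' z * y) = (\<lambda>v. 0)"
        using Rolle_deriv[OF \<open>a < b\<close>, of h "\<lambda>x y. h' x * y"] by blast
      have "h' z = 0"
        using fun_cong[OF z(3), of 1] by simp
      moreover have "z \<notin> Z'"
        using Z'(4)[of z] z by (auto simp: a_def)
      moreover have "Max (insert b A) = b"
        using insert.hyps by (intro Max_eqI) auto
      moreover have "b \<notin> A"
        using insert.hyps by auto
      moreover have "y < b" if "y \<in> Z'" for y
        using Z'(4)[OF that] a by (auto simp: a_def)
      ultimately show ?thesis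
        using Z' z S[of z] insert.hyps by (intro exI[of _ "insert z Z'"]) auto
    qed
  qed
  then show ?thesis using that by blast
qed

text \<open>
  Powers of pairwise non-proportional affine functions form a Chebyshev system. Dividing the sum by one
  of its terms turns that term into a constant, and the derivative of the quotient is, up to a positive
  factor, a sum of the same kind with one term fewer and exponent \<open>\<sigma> - 1\<close>. So each
  application of Rolle's theorem costs one term and one zero. The exponent avoids the natural numbers
  because otherwise it could reach \<open>0\<close>, where the differentiated sum can vanish identically.
\<close>

lemma card_zeros_powr_sum_less:
  fixes p q c :: "'a \<Rightarrow> real" and \<sigma> :: real
  assumes "finite J" "\<And>i j. i \<in> J \<Longrightarrow> j \<in> J \<Longrightarrow> i \<noteq> j \<Longrightarrow> p i * q j \<noteq> p j * q i"
    and "\<sigma> \<notin> \<nat>" "\<exists>j\<in>J. c j \<noteq> 0" "finite Z"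
    and "\<And>z j. z \<in> Z \<Longrightarrow> j \<in> J \<Longrightarrow> 0 < p j + q j * z"
    and "\<And>z. z \<in> Z \<Longrightarrow> (\<Sum>j\<in>J. c j * (p j + q j * z) powr \<sigma>) = 0"
  shows "card Z < card J"
  using assms
proof (induction J arbitrary: \<sigma> c Z rule: finite_induct)
  case empty
  then show ?case by simp
next
  case (insert i J)
  show ?case
  proof (cases "Z = {} \<or> (\<forall>j\<in>J. c j = 0)")
    case True
    have "z \<notin> Z" if c0: "\<forall>j\<in>J. c j = 0" for z
    proof
      assume z: "z \<in> Z"
      have "c i * (p i + q i * z) powr \<sigma> = 0"
        using insert.prems(6)[OF z] insert.hyps c0 by simp
      moreover have "c i \<noteq> 0" using insert.prems(3) c0 by auto
      ultimately show False using insert.prems(5)[OF z, of i] by simp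
    qed
    then have "Z = {}" using True by auto
    then show ?thesis using insert.hyps by (simp add: card_gt_0_iff)
  next
    case False
    define P where "P = (\<lambda>j x. p j + q j * x)"
    define S where "S = {x. \<forall>j\<in>insert i J. 0 < P j x}"
    define h where "h = (\<lambda>x. c i + (\<Sum>j\<in>J. c j * (P j x / P i x) powr \<sigma>))"
    define D where "D = (\<lambda>j. q j * p i - p j * q i)"
    define g where "g = (\<lambda>x. (\<Sum>j\<in>J. (c j * \<sigma> * D j) * P j x powr (\<sigma> - 1)))"
    define h' where "h' = (\<lambda>x. P i x powr (- \<sigma> - 1) * g x)"
    have interval: "is_interval S"
      unfolding is_interval_1
    proof (intro ballI allI impI)
      fix a b x assume ab: "a \<in> S" "b \<in> S" "a \<le> x \<and> x \<le> b"
      have "0 < P j x" if j: "j \<in> insert i J" for j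
      proof (cases "q j \<ge> 0")
        case True
        then have "P j a \<le> P j x" using ab by (simp add: P_def mult_left_mono)
        then show ?thesis using ab j by (fastforce simp: S_def)
      next
        case False
        then have "P j b \<le> P j x" using ab by (simp add: P_def mult_left_mono_neg)
        then show ?thesis using ab j by (fastforce simp: S_def)
      qed
      then show "x \<in> S" by (simp add: S_def)
    qed
    have ZS: "Z \<subseteq> S" using insert.prems(5) by (auto simp: S_def P_def)
    have h0: "h z = 0" if z: "z \<in> Z" for z
    proof -
      have pos: "0 < P j z" if "j \<in> insert i J" for j
        using ZS z that by (auto simp: S_def)
      have pi: "P i z \<noteq> 0" using pos[of i] by simp
      have "P i z powr \<sigma> * h z = c i * P i z powr \<sigma> + (\<Sum>j\<in>J. c j * P j z powr \<sigma>)"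
        using pos pi unfolding h_def sum_distrib_left distrib_left
        by (intro arg_cong2[of _ _ _ _ "(+)"] sum.cong) (auto simp: powr_divide less_imp_le)
      also have "\<dots> = 0"
        using insert.prems(6)[OF z] insert.hyps by (simp add: P_def)
      finally show ?thesis using pos[of i] by simp
    qed
    have deriv: "(h has_real_derivative h' x) (at x)" if x: "x \<in> S" for x
    proof -
      have pos: "0 < P j x" if "j \<in> insert i J" for j
        using x that by (auto simp: S_def)
      have "((\<lambda>x. c j * (P j x / P i x) powr \<sigma>) has_real_derivative
              P i x powr (- \<sigma> - 1) * ((c j * \<sigma> * D j) * P j x powr (\<sigma> - 1))) (at x)"
        if j: "j \<in> J" for j
      proof -
        have "P j x > 0" "P i x > 0" using pos j by auto
        have "((\<lambda>x. P j x / P i x) has_real_derivative D j / (P i x)\<^sup>2) (at x)"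
          unfolding P_def using \<open>P i x > 0\<close>
          by (auto intro!: derivative_eq_intros simp: P_def D_def power2_eq_square field_simps)
        then have "((\<lambda>x. (P j x / P i x) powr \<sigma>) has_real_derivative
              \<sigma> * (P j x / P i x) powr (\<sigma> - 1) * (D j / (P i x)\<^sup>2)) (at x)"
          using DERIV_fun_powr[of "\<lambda>x. P j x / P i x" "D j / (P i x)\<^sup>2" x \<sigma>] \<open>P j x > 0\<close> \<open>P i x > 0\<close>
          by (simp only: of_nat_1 divide_pos_pos)
        moreover have quot: "(P j x / P i x) powr (\<sigma> - 1) / (P i x)\<^sup>2
            = P i x powr (- \<sigma> - 1) * P j x powr (\<sigma> - 1)"
        proof -
          have "(P i x)\<^sup>2 = P i x powr 2"
            using \<open>P i x > 0\<close> by (simp add: powr_numeral)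
          then have "P i x powr (\<sigma> - 1) * (P i x)\<^sup>2 * P i x powr (- \<sigma> - 1) = P i x powr (\<sigma> - 1 + 2 + (- \<sigma> - 1))"
            by (simp only: powr_add)
          also have "\<dots> = 1" using \<open>P i x > 0\<close> by simp
          finally show ?thesis
            using \<open>P j x > 0\<close> \<open>P i x > 0\<close> by (simp add: powr_divide field_simps)
        qed
        moreover have "\<sigma> * (P j x / P i x) powr (\<sigma> - 1) * (D j / (P i x)\<^sup>2)
            = \<sigma> * D j * (P i x powr (- \<sigma> - 1) * P j x powr (\<sigma> - 1))"
          unfolding quot[symmetric] by simp
        ultimately have "((\<lambda>x. (P j x / P i x) powr \<sigma>) has_real_derivative
              \<sigma> * D j * (P i x powr (- \<sigma> - 1) * P j x powr (\<sigma> - 1))) (at x)"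
          by simp
        from DERIV_cmult[OF this, of "c j"] show ?thesis by (simp add: mult_ac)
      qed
      then have "(h has_real_derivative 0 +
          (\<Sum>j\<in>J. P i x powr (- \<sigma> - 1) * ((c j * \<sigma> * D j) * P j x powr (\<sigma> - 1)))) (at x)"
        unfolding h_def by (intro DERIV_add DERIV_const DERIV_sum)
      then show ?thesis by (simp add: h'_def g_def sum_distrib_left)
    qed
    obtain Z' where Z': "finite Z'" "Z' \<subseteq> S" "card Z = Suc (card Z')" "\<And>z. z \<in> Z' \<Longrightarrow> h' z = 0"
      using Rolle_count[OF insert.prems(4) _ ZS interval h0 deriv] False by blast
    have "card Z' < card J"
    proof (rule insert.IH[where \<sigma> = "\<sigma> - 1" and c = "\<lambda>j. c j * \<sigma> * D j"])
      show "\<sigma> - 1 \<notin> \<nat>"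
        using insert.prems(2) Nats_add[OF _ Nats_1, of "\<sigma> - 1"] by auto
      have "\<sigma> \<noteq> 0" using insert.prems(2) by auto
      moreover have "D j \<noteq> 0" if "j \<in> J" for j
        using insert.prems(1)[of i j] insert.hyps(2) that by (auto simp: D_def mult.commute)
      ultimately show "\<exists>j\<in>J. c j * \<sigma> * D j \<noteq> 0" using False by auto
      show "(\<Sum>j\<in>J. c j * \<sigma> * D j * (p j + q j * z) powr (\<sigma> - 1)) = 0" if "z \<in> Z'" for z
      proof -
        have "P i z > 0" using that Z'(2) by (auto simp: S_def)
        then show ?thesis using Z'(4)[OF that] by (simp add: h'_def g_def P_def)
      qed
      show "0 < p j + q j * z" if "z \<in> Z'" "j \<in> J" for z j
        using that Z'(2) by (auto simp: S_def P_def)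
    qed (use insert.prems(1) Z' in auto)
    then show ?thesis using Z' insert.hyps by simp
  qed
qed

section \<open>Integer combinations of the columns of a matrix\<close>

text \<open>
  The pigeonhole principle on the vectors \<open>\<Sum>b\<in>B. x b * w l b\<close> with \<open>x b \<in> {0..H}\<close>: cut into cells
  of side \<open>1/K\<close>, the range of these \<open>L\<close>-dimensional vectors has fewer cells than there are choices of
  \<open>x\<close>, and \<open>\<delta>\<close> is the difference of two choices that share a cell.
\<close>

lemma small_integer_combination:
  fixes w :: "nat \<Rightarrow> 'b \<Rightarrow> real" and K H W L :: nat
  assumes B: "finite B" and w: "\<And>l b. l < L \<Longrightarrow> b \<in> B \<Longrightarrow> \<bar>w l b\<bar> \<le> real W"
    and K: "K > 0"
    and big: "(2 * (K * H * card B * W) + 1) ^ L < (H + 1) ^ card B"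
  obtains \<delta> :: "'b \<Rightarrow> int" where "\<exists>b\<in>B. \<delta> b \<noteq> 0" "\<And>b. b \<in> B \<Longrightarrow> \<bar>\<delta> b\<bar> \<le> int H"
    "\<And>l. l < L \<Longrightarrow> \<bar>\<Sum>b\<in>B. \<delta> b * w l b\<bar> < 1 / real K"
proof -
  define R where "R = K * H * card B * W"
  define T where "T = B \<rightarrow>\<^sub>E {0..int H}"
  define y where "y = (\<lambda>x l. real K * (\<Sum>b\<in>B. real_of_int (x b) * w l b))"
  define \<phi> where "\<phi> = (\<lambda>x. restrict (\<lambda>l. \<lfloor>y x l\<rfloor>) {..<L})"
  have "\<bar>y x l\<bar> \<le> real R" if x: "x \<in> T" and l: "l < L" for x l
  proof -
    have "\<bar>\<Sum>b\<in>B. real_of_int (x b) * w l b\<bar> \<le> (\<Sum>b\<in>B. real H * real W)"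
    proof (rule sum_abs[THEN order_trans], rule sum_mono)
      fix b assume b: "b \<in> B"
      then have "x b \<in> {0..int H}" using x unfolding T_def by (rule PiE_mem[rotated])
      then have "\<bar>real_of_int (x b)\<bar> \<le> real H" by simp
      then show "\<bar>real_of_int (x b) * w l b\<bar> \<le> real H * real W"
        unfolding abs_mult using w[OF l b] by (intro mult_mono) auto
    qed
    then have "real K * \<bar>\<Sum>b\<in>B. real_of_int (x b) * w l b\<bar> \<le> real K * (\<Sum>b\<in>B. real H * real W)"
      by (intro mult_left_mono) auto
    then show ?thesis by (simp add: y_def abs_mult R_def mult_ac)
  qed
  then have "\<lfloor>y x l\<rfloor> \<in> {- int R..int R}" if "x \<in> T" "l < L" for x l
    using that by (fastforce simp: abs_le_iff le_floor_iff floor_le_iff)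
  then have "\<phi> ` T \<subseteq> {..<L} \<rightarrow>\<^sub>E {- int R..int R}"
    by (auto simp: \<phi>_def split: if_splits)
  then have "card (\<phi> ` T) \<le> card ({..<L} \<rightarrow>\<^sub>E {- int R..int R})"
    by (intro card_mono finite_PiE) auto
  also have "\<dots> = (2 * R + 1) ^ L"
    by (simp add: card_funcsetE nat_add_distrib nat_mult_distrib flip: mult_2)
  also have "\<dots> < card T"
    using big B by (simp add: T_def card_funcsetE R_def nat_add_distrib)
  finally obtain x x' where xx: "x \<in> T" "x' \<in> T" "x \<noteq> x'" "\<phi> x = \<phi> x'"
    using pigeonhole[of \<phi> T] by (auto simp: inj_on_def)
  show thesis
  proof
    show "\<exists>b\<in>B. x b - x' b \<noteq> 0"
      using xx PiE_ext[of x B "\<lambda>_. {0..int H}" x'] by (auto simp: T_def)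
    show "\<bar>x b - x' b\<bar> \<le> int H" if "b \<in> B" for b
      using PiE_mem[OF xx(1)[unfolded T_def] that] PiE_mem[OF xx(2)[unfolded T_def] that] by auto
    show "\<bar>\<Sum>b\<in>B. (x b - x' b) * w l b\<bar> < 1 / real K" if l: "l < L" for l
    proof -
      have "\<lfloor>y x l\<rfloor> = \<lfloor>y x' l\<rfloor>"
        using fun_cong[OF xx(4), of l] l by (simp add: \<phi>_def)
      then have "\<bar>y x l - y x' l\<bar> < 1" by linarith
      also have "y x l - y x' l = real K * (\<Sum>b\<in>B. (x b - x' b) * w l b)"
        by (simp add: y_def algebra_simps sum_subtractf)
      finally show ?thesis using K by (simp add: abs_mult field_simps)
    qed
  qed
qed

section \<open>Grids on which a fractional power is integral\<close>

lemma abs_gbinomial_le_one: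
  fixes s :: real
  assumes "0 \<le> s" "s \<le> 1"
  shows "\<bar>s gchoose l\<bar> \<le> 1"
proof (induction l)
  case (Suc l)
  have "s gchoose Suc l = (s gchoose l) * ((s - real l) / real (Suc l))"
    using gbinomial_mult_1[of s l] by (simp add: field_simps)
  moreover have "\<bar>(s - real l) / real (Suc l)\<bar> \<le> 1"
    using assms by (simp add: abs_le_iff divide_le_eq)
  ultimately show ?case
    using Suc mult_mono[of "\<bar>s gchoose l\<bar>" 1 "\<bar>(s - real l) / real (Suc l)\<bar>" 1]
    by (simp add: abs_mult)
qed simp

lemma binomial_series_truncation:
  fixes s z :: real
  assumes s: "0 \<le> s" "s \<le> 1" and z: "\<bar>z\<bar> \<le> 1/2"
  shows "\<bar>(1 + z) powr s - (\<Sum>l<L. (s gchoose l) * z ^ l)\<bar> \<le> 2 / 2 ^ L"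
proof -
  have "(\<lambda>l. (s gchoose l) * z ^ l) sums (1 + z) powr s"
    using z by (intro gen_binomial_real) auto
  then have tail: "(\<lambda>l. (s gchoose (l + L)) * z ^ (l + L)) sums
      ((1 + z) powr s - (\<Sum>l<L. (s gchoose l) * z ^ l))"
    by (rule sums_split_initial_segment)
  have geo: "(\<lambda>l. (1/2) ^ L * (1/2 :: real) ^ l) sums ((1/2) ^ L * (1 / (1 - 1/2)))"
    by (intro sums_mult geometric_sums) auto
  have "norm ((s gchoose (l + L)) * z ^ (l + L)) \<le> (1/2) ^ L * (1/2) ^ l" for l
  proof -
    have "\<bar>z\<bar> ^ (l + L) \<le> (1/2) ^ (l + L)" using z by (intro power_mono) auto
    then show ?thesis
      using mult_mono[OF abs_gbinomial_le_one[OF s, of "l + L"]]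
      by (fastforce simp: abs_mult power_abs power_add mult.commute)
  qed
  then have "norm (\<Sum>l. (s gchoose (l + L)) * z ^ (l + L)) \<le> (\<Sum>l. (1/2) ^ L * (1/2) ^ l)"
    by (intro norm_suminf_le sums_summable[OF geo])
  then show ?thesis
    using sums_unique[OF tail] sums_unique[OF geo] by (simp add: power_divide)
qed

text \<open>
  The factorisation writes the matrix of values \<open>(n + b * a) powr s\<close> as a power series in
  \<open>u a * v b\<close>, so up to an error of order \<open>1 / 2 ^ L\<close> it has rank \<open>L\<close>. With \<open>2 * L\<close> columns the
  pigeonhole principle then gives a nontrivial integer combination of the columns whose entries are all
  smaller than \<open>1\<close> in absolute value. These entries are integers, hence \<open>0\<close>: the function
  \<open>x \<mapsto> (\<Sum>b\<in>B'. \<delta> b * (n + b * x) powr s)\<close> vanishes on all of \<open>A\<close>. By the zero estimate, \<open>A\<close> has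
  fewer than \<open>2 * L\<close> elements.
\<close>

lemma integral_power_grid_small:
  fixes A B :: "real set" and s n :: real and \<alpha> \<beta> u v :: "real \<Rightarrow> real" and M L :: nat
  assumes fin: "finite A" "finite B" and s: "0 < s" "s < 1" and "n \<noteq> 0"
    and pos: "\<And>a b. a \<in> A \<Longrightarrow> b \<in> B \<Longrightarrow> 0 < n + b * a"
    and int: "\<And>a b. a \<in> A \<Longrightarrow> b \<in> B \<Longrightarrow> (n + b * a) powr s \<in> \<int>"
    and split: "\<And>a b. a \<in> A \<Longrightarrow> b \<in> B \<Longrightarrow>
      (n + b * a) powr s = \<alpha> a * \<beta> b * (1 + u a * v b) powr s"
    and \<alpha>: "\<And>a. a \<in> A \<Longrightarrow> \<bar>\<alpha> a\<bar> \<le> real M" and \<beta>: "\<And>b. b \<in> B \<Longrightarrow> \<bar>\<beta> b\<bar> \<le> real M"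
    and u: "\<And>a. a \<in> A \<Longrightarrow> \<bar>u a\<bar> \<le> 1" and v: "\<And>b. b \<in> B \<Longrightarrow> \<bar>v b\<bar> \<le> 1/2"
    and M: "M > 0" and L: "L > 0" "64 * M ^ 4 * L ^ 3 \<le> 2 ^ L"
  shows "card A < 2 * L \<or> card B < 2 * L"
proof (rule ccontr)
  assume "\<not> ?thesis"
  then have large: "2 * L \<le> card A" "2 * L \<le> card B" by auto
  obtain B' where B': "B' \<subseteq> B" "card B' = 2 * L" "finite B'"
    using obtain_subset_with_card_n[OF large(2)] by metis
  \<comment> \<open>With these choices the pigeonhole count is exactly \<open>(H\<^sup>2 + 1) ^ L < (H + 1) ^ (2 * L)\<close>, and the
      \<open>L\<close> retained terms of the series contribute less than \<open>L / K = 1 / (2 * M)\<close>.\<close>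
  define K where "K = 2 * M * L"
  define H where "H = 8 * M\<^sup>2 * L\<^sup>2"
  have w: "\<bar>\<beta> b * v b ^ l\<bar> \<le> real M" if "b \<in> B'" for b l
  proof -
    have "\<bar>v b\<bar> ^ l \<le> 1" using v[of b] that B' by (intro power_le_one) auto
    then show ?thesis
      using mult_mono[of "\<bar>\<beta> b\<bar>" "real M" "\<bar>v b\<bar> ^ l" 1] \<beta>[of b] that B'
      by (auto simp: abs_mult power_abs)
  qed
  have "2 * (K * H * card B' * M) + 1 = H ^ 2 + 1"
    by (simp add: B' K_def H_def power2_eq_square)
  also have "\<dots> < (H + 1) ^ 2"
    using M L by (simp add: power2_eq_square H_def)
  finally have "(2 * (K * H * card B' * M) + 1) ^ L < ((H + 1) ^ 2) ^ L"
    using L by (intro power_strict_mono) auto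
  then have "(2 * (K * H * card B' * M) + 1) ^ L < (H + 1) ^ card B'"
    by (simp only: B' power_mult)
  then obtain \<delta> :: "real \<Rightarrow> int" where \<delta>: "\<exists>b\<in>B'. \<delta> b \<noteq> 0"
      "\<And>b. b \<in> B' \<Longrightarrow> \<bar>\<delta> b\<bar> \<le> int H"
      "\<And>l. l < L \<Longrightarrow> \<bar>\<Sum>b\<in>B'. \<delta> b * (\<beta> b * v b ^ l)\<bar> < 1 / real K"
    using small_integer_combination[of B' L "\<lambda>l b. \<beta> b * v b ^ l" M K H] B' w M L
    by (auto simp: K_def)
  have zero: "(\<Sum>b\<in>B'. \<delta> b * (n + b * a) powr s) = 0" if a: "a \<in> A" for a
  proof -
    define t where "t = (\<lambda>b. (1 + u a * v b) powr s - (\<Sum>l<L. (s gchoose l) * (u a * v b) ^ l))"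
    define main where "main = (\<Sum>l<L. (s gchoose l) * u a ^ l * (\<Sum>b\<in>B'. \<delta> b * (\<beta> b * v b ^ l)))"
    define tail where "tail = (\<Sum>b\<in>B'. \<delta> b * \<beta> b * t b)"
    have "(\<Sum>b\<in>B'. \<delta> b * (n + b * a) powr s)
        = (\<Sum>b\<in>B'. \<delta> b * (\<alpha> a * \<beta> b * ((\<Sum>l<L. (s gchoose l) * (u a * v b) ^ l) + t b)))"
      using a B' by (intro sum.cong) (auto simp: split t_def)
    also have "\<dots> = \<alpha> a * ((\<Sum>b\<in>B'. \<Sum>l<L. (s gchoose l) * u a ^ l * (\<delta> b * (\<beta> b * v b ^ l))) + tail)"
      by (simp add: tail_def distrib_left sum.distrib sum_distrib_left power_mult_distrib mult_ac)
    also have "\<dots> = \<alpha> a * (main + tail)"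
      unfolding main_def sum_distrib_left by (subst sum.swap) simp
    finally have eq: "(\<Sum>b\<in>B'. \<delta> b * (n + b * a) powr s) = \<alpha> a * (main + tail)" .
    have "\<bar>main\<bar> < (\<Sum>l<L. 1 / real K)"
      unfolding main_def
    proof (rule le_less_trans[OF sum_abs], rule sum_strict_mono)
      fix l assume l: "l \<in> {..<L}"
      have "\<bar>u a\<bar> ^ l \<le> 1" using u[OF a] by (intro power_le_one) auto
      then have "\<bar>(s gchoose l) * u a ^ l\<bar> \<le> 1"
        using mult_mono[OF abs_gbinomial_le_one[of s l], of "\<bar>u a\<bar> ^ l" 1] s
        by (simp add: abs_mult power_abs)
      then have "\<bar>(s gchoose l) * u a ^ l * (\<Sum>b\<in>B'. \<delta> b * (\<beta> b * v b ^ l))\<bar>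
          \<le> 1 * \<bar>\<Sum>b\<in>B'. \<delta> b * (\<beta> b * v b ^ l)\<bar>"
        unfolding abs_mult[of _ "sum _ _"] by (intro mult_right_mono) auto
      then show "\<bar>(s gchoose l) * u a ^ l * (\<Sum>b\<in>B'. \<delta> b * (\<beta> b * v b ^ l))\<bar> < 1 / real K"
        using \<delta>(3)[of l] l by simp
    qed (use L in auto)
    then have main: "\<bar>main\<bar> < 1 / (2 * real M)"
      using M L by (simp add: K_def field_simps)
    have "\<bar>tail\<bar> \<le> (\<Sum>b\<in>B'. (real H * real M) * (2 / 2 ^ L))"
      unfolding tail_def
    proof (rule order_trans[OF sum_abs], rule sum_mono)
      fix b assume b: "b \<in> B'"
      have "\<bar>u a * v b\<bar> \<le> 1 * (1/2)"
        unfolding abs_mult using u[OF a] v[of b] b B' by (intro mult_mono) auto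
      then have t: "\<bar>t b\<bar> \<le> 2 / 2 ^ L"
        unfolding t_def using s by (intro binomial_series_truncation) auto
      have "\<bar>real_of_int (\<delta> b)\<bar> \<le> real H" using \<delta>(2)[OF b] by linarith
      then show "\<bar>\<delta> b * \<beta> b * t b\<bar> \<le> (real H * real M) * (2 / 2 ^ L)"
        unfolding abs_mult using t \<beta>[of b] b B' by (intro mult_mono) auto
    qed
    also have "\<dots> = 32 * real M ^ 3 * real L ^ 3 / 2 ^ L"
      by (simp add: B' H_def power2_eq_square power3_eq_cube)
    also have "\<dots> \<le> 1 / (2 * real M)"
    proof -
      have "real (64 * M ^ 4 * L ^ 3) \<le> real (2 ^ L)" using L(2) by (simp only: of_nat_le_iff)
      then show ?thesis using M by (simp add: field_simps power3_eq_cube power4_eq_xxxx)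
    qed
    finally have "\<bar>main + tail\<bar> < 1 / real M" using main by (simp add: field_simps)
    then have "real M * \<bar>main + tail\<bar> < 1" using M by (simp add: field_simps)
    moreover have "\<bar>\<alpha> a\<bar> * \<bar>main + tail\<bar> \<le> real M * \<bar>main + tail\<bar>"
      using \<alpha>[OF a] by (intro mult_right_mono) auto
    ultimately have "\<bar>\<alpha> a * (main + tail)\<bar> < 1"
      unfolding abs_mult by linarith
    moreover have "(\<Sum>b\<in>B'. \<delta> b * (n + b * a) powr s) \<in> \<int>"
      using int a B' by (intro Ints_sum Ints_mult) auto
    ultimately show ?thesis
      unfolding eq by (metis Ints_nonzero_abs_less1)
  qed
  have "card A < card B'"
  proof (rule card_zeros_powr_sum_less[where p = "\<lambda>_. n" and q = "\<lambda>b. b" and \<sigma> = s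
        and c = "\<lambda>b. real_of_int (\<delta> b)"])
    show "s \<notin> \<nat>" using s by (auto elim!: Nats_cases)
  qed (use B' \<open>n \<noteq> 0\<close> \<delta>(1) fin zero pos in auto)
  then show False using large B' by simp
qed

text \<open>
  The choice \<open>L = 48 + 8 * t\<close> meets the numerical condition of the preceding lemma for the bound
  \<open>M = 2 ^ t\<close>: half of \<open>8 * t\<close> absorbs \<open>M ^ 4\<close>, the other half,
  together with the constant \<open>48\<close>, the factor \<open>64 * L ^ 3\<close>.
\<close>

lemma cubic_le_exponential: "64 * (2 ^ t) ^ 4 * (48 + 8 * t) ^ 3 \<le> (2::nat) ^ (48 + 8 * t)"
proof -
  have "64 * (48 + 8 * t) ^ 3 \<le> (2::nat) ^ (24 + 4 * t)"
  proof (induction t)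
    case (Suc t)
    have "48 + 8 * Suc t \<le> 2 * (48 + 8 * t)" by simp
    then have "(48 + 8 * Suc t) ^ 3 \<le> (2 * (48 + 8 * t)) ^ 3" by (intro power_mono) auto
    also have "\<dots> = 8 * (48 + 8 * t) ^ 3" by (simp only: power_mult_distrib) simp
    finally have "64 * (48 + 8 * Suc t) ^ 3 \<le> 8 * (64 * (48 + 8 * t) ^ 3)" by linarith
    also have "\<dots> \<le> 16 * 2 ^ (24 + 4 * t)" using Suc by linarith
    also have "\<dots> = 2 ^ (24 + 4 * Suc t)" by (simp add: power_add)
    finally show ?case .
  qed simp
  then have "(2 ^ t) ^ 4 * (64 * (48 + 8 * t) ^ 3) \<le> 2 ^ (4 * t) * (2::nat) ^ (24 + 4 * t)"
    by (intro mult_mono) (auto simp: mult.commute simp flip: power_mult)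
  also have "\<dots> = 2 ^ (24 + 8 * t)" by (simp flip: power_add)
  also have "\<dots> \<le> 2 ^ (48 + 8 * t)" by (intro power_increasing) auto
  finally show ?thesis by (simp only: mult_ac)
qed

text \<open>
  When \<open>\<bar>n\<bar> / (a * b) \<le> 1/2\<close> throughout, the series is taken in \<open>n / (a * b)\<close>, after pulling out
  \<open>(a * b) powr (1 / k)\<close>; when \<open>a * b / n \<le> 1/2\<close>, it is taken in \<open>a * b / n\<close>, after pulling out
  \<open>n powr (1 / k)\<close>. The extremal element \<open>c\<close> of \<open>A\<close> only rescales the two variables so that the first
  one is at most \<open>1\<close> and the second one at most \<open>1/2\<close>.
\<close>

lemma kth_power_grid_small:
  fixes A B :: "nat set" and n :: int and k t :: nat
  assumes k: "2 \<le> k" and "n \<noteq> 0" and fin: "finite A" "finite B"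
    and pos: "\<And>a. a \<in> A \<Longrightarrow> 0 < a" "\<And>b. b \<in> B \<Longrightarrow> 0 < b"
    and power: "\<And>a b. a \<in> A \<Longrightarrow> b \<in> B \<Longrightarrow> \<exists>x>0. int (a * b) + n = int x ^ k"
    and bound: "\<And>a. a \<in> A \<Longrightarrow> a \<le> 2 ^ t" "\<And>b. b \<in> B \<Longrightarrow> b \<le> 2 ^ t" "\<bar>n\<bar> \<le> 2 ^ t"
    and away: "(\<forall>a\<in>A. \<forall>b\<in>B. 2 * \<bar>n\<bar> \<le> int (a * b)) \<or>
      (0 < n \<and> (\<forall>a\<in>A. \<forall>b\<in>B. 2 * int (a * b) \<le> n))"
  shows "card A < 96 + 16 * t \<or> card B < 96 + 16 * t"
proof (cases "A = {}")
  case True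
  then show ?thesis by simp
next
  case False
  define s where "s = 1 / real k"
  have s: "0 < s" "s < 1" using k by (auto simp: s_def)
  define \<nu> where "\<nu> = real_of_int n"
  define L where "L = 48 + 8 * t"
  have \<nu>: "\<nu> \<noteq> 0" "\<bar>\<nu>\<bar> \<le> real (2 ^ t)"
    using \<open>n \<noteq> 0\<close> bound(3) of_int_le_iff[of "\<bar>n\<bar>" "2 ^ t", where 'a = real] by (auto simp: \<nu>_def)
  have root: "\<exists>x>0. \<nu> + real b * real a = real x ^ k" if ab: "a \<in> A" "b \<in> B" for a b
  proof -
    obtain x where x: "x > 0" "int (a * b) + n = int x ^ k" using power[OF ab] by blast
    have "\<nu> + real b * real a = real_of_int (int (a * b) + n)" by (simp add: \<nu>_def)
    also have "\<dots> = real_of_int (int x ^ k)" by (simp only: x)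
    also have "\<dots> = real x ^ k" by simp
    finally show ?thesis using x(1) by blast
  qed
  have entry: "0 < \<nu> + b * a" "(\<nu> + b * a) powr s \<in> \<int>" if ab: "a \<in> real ` A" "b \<in> real ` B" for a b
  proof -
    obtain x :: nat where x: "x > 0" "\<nu> + b * a = real x ^ k" using root ab by blast
    then show "0 < \<nu> + b * a" by simp
    have "(real x ^ k) powr s = real x powr (real k * s)"
      using x(1) by (simp add: powr_powr flip: powr_realpow)
    then show "(\<nu> + b * a) powr s \<in> \<int>" using x k by (simp add: s_def)
  qed
  have le_base: "y powr s \<le> real (2 ^ t)" if "1 \<le> y" "y \<le> real (2 ^ t)" for y
    using powr_mono[of s 1 y] s that by simp
  have M: "0 < (2::nat) ^ t" by simp
  have L: "0 < L" "64 * (2 ^ t) ^ 4 * L ^ 3 \<le> 2 ^ L"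
    using cubic_le_exponential[of t] unfolding L_def by auto
  have fin': "finite (real ` A)" "finite (real ` B)" using fin by auto
  have "card (real ` A) < 2 * L \<or> card (real ` B) < 2 * L"
    using away
  proof
    assume far: "\<forall>a\<in>A. \<forall>b\<in>B. 2 * \<bar>n\<bar> \<le> int (a * b)"
    define c where "c = real (Min A)"
    have c: "Min A \<in> A" "0 < c" "\<And>a. a \<in> A \<Longrightarrow> c \<le> real a"
      using fin False pos by (auto simp: c_def)
    show ?thesis
    proof (rule integral_power_grid_small[OF fin' s \<nu>(1) entry, where M = "2 ^ t"
          and \<alpha> = "\<lambda>a. a powr s" and \<beta> = "\<lambda>b. b powr s" and u = "\<lambda>a. c / a" and v = "\<lambda>b. \<nu> / (c * b)"])
      fix a b assume ab: "a \<in> real ` A" "b \<in> real ` B"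
      then have p: "0 < a" "0 < b" using pos by auto
      have "\<nu> + b * a = a * b * (1 + c / a * (\<nu> / (c * b)))"
        using p c(2) by (simp add: field_simps)
      moreover have "0 < 1 + c / a * (\<nu> / (c * b))"
        using entry(1)[OF ab] p calculation by (metis mult_pos_pos zero_less_mult_pos)
      ultimately show "(\<nu> + b * a) powr s = a powr s * b powr s * (1 + c / a * (\<nu> / (c * b))) powr s"
        using p by (simp only: powr_mult less_imp_le mult_nonneg_nonneg)
    next
      fix a assume "a \<in> real ` A"
      then obtain a' where a': "a = real a'" "a' \<in> A" by blast
      then have "1 \<le> a" "a \<le> real (2 ^ t)" using pos(1)[of a'] bound(1)[of a'] by (auto simp del: of_nat_power)
      then show "\<bar>a powr s\<bar> \<le> real (2 ^ t)" using le_base by simp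
      show "\<bar>c / a\<bar> \<le> 1" using c a' \<open>1 \<le> a\<close> by simp
    next
      fix b assume "b \<in> real ` B"
      then obtain b' where b': "b = real b'" "b' \<in> B" by blast
      then have "1 \<le> b" "b \<le> real (2 ^ t)" using pos(2)[of b'] bound(2)[of b'] by (auto simp del: of_nat_power)
      then show "\<bar>b powr s\<bar> \<le> real (2 ^ t)" using le_base by simp
      have "2 * \<bar>n\<bar> \<le> int (Min A * b')" using far c(1) b' by blast
      then have "real_of_int (2 * \<bar>n\<bar>) \<le> real_of_int (int (Min A * b'))" by (simp only: of_int_le_iff)
      then have "2 * \<bar>\<nu>\<bar> \<le> c * b" by (simp add: \<nu>_def c_def b')
      then show "\<bar>\<nu> / (c * b)\<bar> \<le> 1/2" using c(2) \<open>1 \<le> b\<close> by (simp add: abs_mult field_simps)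
    qed (use M L in auto)
  next
    assume near: "0 < n \<and> (\<forall>a\<in>A. \<forall>b\<in>B. 2 * int (a * b) \<le> n)"
    define c where "c = real (Max A)"
    have c: "Max A \<in> A" "0 < c" "\<And>a. a \<in> A \<Longrightarrow> real a \<le> c"
      using fin False pos by (auto simp: c_def)
    have \<nu>1: "1 \<le> \<nu>" using near by (simp add: \<nu>_def)
    show ?thesis
    proof (rule integral_power_grid_small[OF fin' s \<nu>(1) entry, where M = "2 ^ t"
          and \<alpha> = "\<lambda>_. \<nu> powr s" and \<beta> = "\<lambda>_. 1" and u = "\<lambda>a. a / c" and v = "\<lambda>b. c * b / \<nu>"])
      fix a b assume ab: "a \<in> real ` A" "b \<in> real ` B"
      have "\<nu> + b * a = \<nu> * (1 + a / c * (c * b / \<nu>))"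
        using \<nu>1 c(2) by (simp add: field_simps)
      moreover have "0 \<le> 1 + a / c * (c * b / \<nu>)" using \<nu>1 c(2) ab by (auto intro!: add_nonneg_nonneg)
      ultimately show "(\<nu> + b * a) powr s = \<nu> powr s * 1 * (1 + a / c * (c * b / \<nu>)) powr s"
        using \<nu>1 by (simp add: powr_mult)
    next
      show "\<bar>\<nu> powr s\<bar> \<le> real (2 ^ t)" using le_base[of \<nu>] \<nu> \<nu>1 by simp
    next
      fix a assume "a \<in> real ` A"
      then show "\<bar>a / c\<bar> \<le> 1" using c by auto
    next
      fix b assume "b \<in> real ` B"
      then obtain b' where b': "b = real b'" "b' \<in> B" by blast
      have "2 * int (Max A * b') \<le> n" using near c(1) b' by blast
      then have "real_of_int (2 * int (Max A * b')) \<le> real_of_int n" by (simp only: of_int_le_iff)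
      then have "2 * (c * b) \<le> \<nu>" by (simp add: \<nu>_def c_def b')
      then show "\<bar>c * b / \<nu>\<bar> \<le> 1/2" using c(2) \<nu>1 b' by (simp add: abs_mult field_simps)
    qed (use M L in auto)
  qed
  then show ?thesis by (simp add: card_image L_def)
qed

section \<open>Subset products\<close>

text \<open>
  Adding a new largest element \<open>b\<close> to \<open>F\<close> creates at least \<open>card F + 1\<close> new products: the full product
  and the full products with one \<open>x \<in> F\<close> left out. All of them exceed the old maximum \<open>\<Prod>F\<close>
  because \<open>x < b\<close>.
\<close>

lemma card_subset_products:
  fixes F :: "nat set"
  assumes "finite F" "\<And>x. x \<in> F \<Longrightarrow> 2 \<le> x"
  shows "card F * (card F + 1) + 2 \<le> 2 * card ((\<lambda>G. \<Prod>G) ` Pow F)"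
  using assms
proof (induction F rule: finite_linorder_max_induct)
  case empty
  then show ?case by simp
next
  case (insert b F)
  have F: "finite F" "b \<notin> F" "\<And>x. x \<in> F \<Longrightarrow> x < b" "\<And>x. x \<in> F \<Longrightarrow> 2 \<le> x" "2 \<le> b"
    using insert.hyps insert.prems by auto
  define old where "old = (\<lambda>G. \<Prod>G) ` Pow F"
  define drop where "drop = (\<lambda>x. \<Prod>(insert b F - {x}))"
  define top where "top = \<Prod>(insert b F)"
  have F_pos: "0 < \<Prod>F" using F(4) by (intro prod_pos) fastforce
  have top: "top = b * \<Prod>F" using F by (simp add: top_def)
  have drop: "drop x * x = top" if "x \<in> F" for x
    using that F(1) prod.remove[of "insert b F" x "\<lambda>x. x"] by (simp add: drop_def top_def mult.commute)
  have drop_gt: "\<Prod>F < drop x" if x: "x \<in> F" for x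
  proof -
    have "x * \<Prod>F < b * \<Prod>F" using F_pos F(3)[OF x] by simp
    also have "\<dots> = x * drop x" using drop[OF x] top by (simp add: mult.commute)
    finally show ?thesis by simp
  qed
  have drop_less: "drop x < top" if x: "x \<in> F" for x
  proof -
    have "0 < drop x" using drop_gt[OF x] by simp
    then have "drop x * 1 < drop x * x" using F(4)[OF x] by (intro mult_strict_left_mono) auto
    then show ?thesis using drop[OF x] by simp
  qed
  have inj: "inj_on drop F"
  proof (rule inj_onI)
    fix x y assume xy: "x \<in> F" "y \<in> F" "drop x = drop y"
    then have "drop x * x = drop x * y" using drop[of x] drop[of y] by simp
    then show "x = y" using drop_gt[OF xy(1)] by simp
  qed
  have old_le: "y \<le> \<Prod>F" if "y \<in> old" for y
    using that F_pos by (auto simp: old_def intro!: dvd_imp_le prod_dvd_prod_subset F(1))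
  have "insert top (drop ` F) \<inter> old = {}"
  proof -
    have "\<Prod>F < top" using F_pos F(5) by (simp add: top)
    then show ?thesis using old_le drop_gt by fastforce
  qed
  moreover have "top \<notin> drop ` F" using drop_less by fastforce
  moreover have "finite old" using F(1) by (simp add: old_def)
  ultimately have "card (insert top (drop ` F) \<union> old) = card F + 1 + card old"
    using F(1) card_image[OF inj] by (simp add: card_Un_disjoint)
  moreover have "insert top (drop ` F) \<union> old \<subseteq> (\<lambda>G. \<Prod>G) ` Pow (insert b F)"
    by (auto simp: top_def drop_def old_def)
  then have "card (insert top (drop ` F) \<union> old) \<le> card ((\<lambda>G. \<Prod>G) ` Pow (insert b F))"
    using F(1) by (intro card_mono) auto
  moreover have "card F * (card F + 1) + 2 \<le> 2 * card old"
    using insert.IH F(4) by (simp add: old_def)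
  ultimately show ?case using F(1,2) by simp
qed

section \<open>The gap principle\<close>

text \<open>
  Consecutive \<open>k\<close>-th powers differ by at least \<open>X ^ (k - 1)\<close>, and \<open>3 * (k - 1) \<ge> 2 * k\<close> exactly when
  \<open>k \<ge> 3\<close>. Cubing and squaring avoid fractional exponents.
\<close>

lemma square_power_le_cube_power_diff:
  fixes X Y :: int
  assumes "0 < X" "X < Y" "3 \<le> k"
  shows "(X ^ k)\<^sup>2 \<le> (Y ^ k - X ^ k) ^ 3"
proof -
  obtain j where k: "k = Suc j" using assms by (cases k) auto
  have "(X + 1) * X ^ j \<le> Y * Y ^ j"
    using assms by (intro mult_mono power_mono) auto
  then have diff: "X ^ j \<le> Y ^ k - X ^ k" by (simp add: k algebra_simps)
  have "(X ^ k)\<^sup>2 = X ^ (2 * k)" by (simp add: mult.commute flip: power_mult)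
  also have "\<dots> \<le> X ^ (j * 3)" using assms k by (intro power_increasing) auto
  also have "\<dots> = (X ^ j) ^ 3" by (simp add: power_mult)
  also have "\<dots> \<le> (Y ^ k - X ^ k) ^ 3" using diff assms by (intro power_mono) auto
  finally show ?thesis .
qed

text \<open>
  The products \<open>(S + n) * (S * u * v + n)\<close> and \<open>(S * u + n) * (S * v + n)\<close> are both \<open>k\<close>-th powers. Their
  difference \<open>n * S * (u - 1) * (v - 1)\<close> is nonzero, and it is far smaller than the products
  themselves, which are about \<open>S\<^sup>2 * u * v\<close>. Since \<open>k\<close>-th powers are sparse, \<open>S\<close> cannot be large
  compared with \<open>n\<close> and \<open>u * v\<close>.
\<close>

lemma gap_principle:
  fixes S u v n :: int and k :: nat
  assumes "3 \<le> k" "n \<noteq> 0" and S: "2 * \<bar>n\<bar> \<le> S" and uv: "2 \<le> u" "2 \<le> v"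
    and cube: "\<And>c. c \<in> {1, u, v, u * v} \<Longrightarrow> \<exists>x>0. S * c + n = x ^ k"
  shows "S \<le> 16 * \<bar>n\<bar> ^ 3 * (u * v)"
proof -
  from cube obtain x0 xu xv xuv where x: "x0 > 0" "S + n = x0 ^ k" "xu > 0" "S * u + n = xu ^ k"
    "xv > 0" "S * v + n = xv ^ k" "xuv > 0" "S * (u * v) + n = xuv ^ k"
    by (metis insertCI mult_1_right)
  have S0: "S > 0" using S \<open>n \<noteq> 0\<close> by auto
  define X where "X = x0 * xuv"
  define Y where "Y = xu * xv"
  have pos: "0 < X" "0 < Y" using x by (auto simp: X_def Y_def)
  have X: "X ^ k = (S + n) * (S * (u * v) + n)" and Y: "Y ^ k = (S * u + n) * (S * v + n)"
    by (simp_all add: X_def Y_def power_mult_distrib x)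
  have diff: "X ^ k - Y ^ k = n * S * ((u - 1) * (v - 1))"
    unfolding X Y by (simp add: algebra_simps)
  then have "X \<noteq> Y" using S0 uv \<open>n \<noteq> 0\<close> by auto
  have half: "S * c \<le> 2 * (S * c + n)" "0 < S * c" if "1 \<le> c" for c
  proof -
    have "S \<le> S * c" using S0 that mult_left_mono[of 1 c S] by simp
    then have "2 * \<bar>n\<bar> \<le> S * c" "0 < S * c" using S S0 by linarith+
    then have "0 \<le> S * c + 2 * n" by linarith
    then show "S * c \<le> 2 * (S * c + n)" by simp
    show "0 < S * c" by fact
  qed
  have uv1: "1 \<le> u * v" using uv mult_mono[of 1 u 1 v] by simp
  have "(S * 1) * (S * (u * v)) \<le> (2 * (S * 1 + n)) * (2 * (S * (u * v) + n))"
    by (rule mult_mono) (use half[OF order.refl] half[OF uv1] in linarith)+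
  then have Xl: "S\<^sup>2 * (u * v) \<le> 4 * X ^ k" by (simp add: X power2_eq_square algebra_simps)
  have "(S * u) * (S * v) \<le> (2 * (S * u + n)) * (2 * (S * v + n))"
    by (rule mult_mono) (use half[of u] half[of v] uv in linarith)+
  then have Yl: "S\<^sup>2 * (u * v) \<le> 4 * Y ^ k" by (simp add: Y power2_eq_square algebra_simps)
  have "\<exists>Z. S\<^sup>2 * (u * v) \<le> 4 * Z \<and> Z\<^sup>2 \<le> \<bar>X ^ k - Y ^ k\<bar> ^ 3"
  proof (cases "X < Y")
    case True
    then have "X ^ k < Y ^ k" using pos \<open>3 \<le> k\<close> by (intro power_strict_mono) auto
    then show ?thesis
      using square_power_le_cube_power_diff[OF pos(1) True \<open>3 \<le> k\<close>] Xl by (intro exI[of _ "X ^ k"]) auto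
  next
    case False
    then have "Y < X" using \<open>X \<noteq> Y\<close> by auto
    moreover from this have "Y ^ k < X ^ k" using pos \<open>3 \<le> k\<close> by (intro power_strict_mono) auto
    ultimately show ?thesis
      using square_power_le_cube_power_diff[OF pos(2) _ \<open>3 \<le> k\<close>] Yl by (intro exI[of _ "Y ^ k"]) auto
  qed
  then obtain Z where Z: "S\<^sup>2 * (u * v) \<le> 4 * Z" "Z\<^sup>2 \<le> \<bar>X ^ k - Y ^ k\<bar> ^ 3" by blast
  have "(u - 1) * (v - 1) \<le> u * v" using uv by (intro mult_mono) auto
  then have "\<bar>X ^ k - Y ^ k\<bar> \<le> \<bar>n\<bar> * S * (u * v)"
    unfolding diff abs_mult using S0 uv by (intro mult_mono) auto
  then have cube_le: "\<bar>X ^ k - Y ^ k\<bar> ^ 3 \<le> (\<bar>n\<bar> * S * (u * v)) ^ 3" by (intro power_mono) auto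
  have "(S\<^sup>2 * (u * v))\<^sup>2 \<le> (4 * Z)\<^sup>2" using Z(1) uv1 by (intro power_mono) auto
  then have "(S\<^sup>2 * (u * v))\<^sup>2 \<le> 16 * (\<bar>n\<bar> * S * (u * v)) ^ 3"
    using Z(2) cube_le by (simp add: power_mult_distrib)
  then have "S * (S ^ 3 * (u * v)\<^sup>2) \<le> (16 * \<bar>n\<bar> ^ 3 * (u * v)) * (S ^ 3 * (u * v)\<^sup>2)"
    by (simp add: power_mult_distrib power2_eq_square power3_eq_cube mult_ac)
  moreover have "0 < S ^ 3 * (u * v)\<^sup>2" using S0 uv1 by (intro mult_pos_pos[OF zero_less_power zero_less_power]) linarith+
  ultimately show ?thesis by (simp only: mult_le_cancel_right_pos)
qed

text \<open>
  In the gap principle \<open>u\<close> and \<open>v\<close> are the two smallest elements of \<open>F\<close>, and \<open>S\<close> is \<open>a0\<close> times the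
  product of all the others. As there are at least four others, \<open>S \<ge> (u * v)\<^sup>2\<close>, so the bound on \<open>S\<close> in
  terms of \<open>u * v\<close> becomes a bound in terms of \<open>n\<close> alone.
\<close>

lemma cube_product_le:
  fixes F :: "nat set" and a0 k :: nat and n :: int
  assumes "3 \<le> k" "n \<noteq> 0" "0 < a0" and F: "finite F" "6 \<le> card F" "\<And>x. x \<in> F \<Longrightarrow> 2 \<le> x"
    and cube: "\<And>G. G \<subseteq> F \<Longrightarrow> \<exists>x>0. int (a0 * \<Prod>G) + n = int x ^ k"
  shows "int (a0 * \<Prod>F) \<le> 4096 * \<bar>n\<bar> ^ 9"
proof -
  define u where "u = Min F"
  have u: "u \<in> F" "\<And>x. x \<in> F \<Longrightarrow> u \<le> x" using F by (auto simp: u_def intro!: Min_in)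
  define v where "v = Min (F - {u})"
  have "card (F - {u}) \<ge> 5" using F u by simp
  then have "F - {u} \<noteq> {}" by force
  then have "v \<in> F - {u}" using F(1) Min_in[of "F - {u}"] by (simp add: v_def)
  then have v: "v \<in> F" "v \<noteq> u" "\<And>x. x \<in> F - {u} \<Longrightarrow> v \<le> x" using F(1) by (auto simp: v_def)
  define F' where "F' = F - {u, v}"
  define S where "S = a0 * \<Prod>F'"
  have F': "finite F'" "u \<notin> F'" "v \<notin> F'" "F = insert u (insert v F')" "F' \<subseteq> F"
    using F u v by (auto simp: F'_def)
  have "card F' \<ge> 4" using F'(1-3) F(2) v(2) by (simp add: F'(4))
  then have "v ^ 4 \<le> v ^ card F'" using F(3)[OF v(1)] by (intro power_increasing) auto
  also have "\<dots> = (\<Prod>x\<in>F'. v)" by simp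
  also have "\<dots> \<le> \<Prod>F'" using v(3) by (intro prod_mono) (auto simp: F'_def)
  also have "\<dots> \<le> S" using \<open>0 < a0\<close> by (simp add: S_def)
  finally have "v ^ 4 \<le> S" .
  moreover have "(u * v)\<^sup>2 \<le> (v * v)\<^sup>2" using u v by (intro power_mono mult_mono) auto
  moreover have "(v * v)\<^sup>2 = v ^ 4" by (simp add: power2_eq_square power4_eq_xxxx)
  ultimately have "(u * v)\<^sup>2 \<le> S" by linarith
  then have uvS: "int ((u * v)\<^sup>2) \<le> int S" by (simp only: of_nat_le_iff)
  have prod: "\<Prod>F = u * v * \<Prod>F'" using F' v(2) by simp
  have corner: "\<exists>x>0. int S * c + n = x ^ k" if c: "c \<in> {1, int u, int v, int u * int v}" for c
  proof -
    have "\<exists>G\<subseteq>{u, v}. c = int (\<Prod>G)"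
    proof -
      have "c = int (\<Prod>{}) \<or> c = int (\<Prod>{u}) \<or> c = int (\<Prod>{v}) \<or> c = int (\<Prod>{u, v})"
        using c v(2) by auto
      then show ?thesis by blast
    qed
    then obtain G where G: "G \<subseteq> {u, v}" "c = int (\<Prod>G)" by blast
    then have "\<Prod>(F' \<union> G) = \<Prod>F' * \<Prod>G"
      using F' finite_subset[OF G(1)] by (intro prod.union_disjoint) auto
    moreover obtain x where "x > 0" "int (a0 * \<Prod>(F' \<union> G)) + n = int x ^ k"
      using cube[of "F' \<union> G"] F' G(1) by auto
    ultimately show ?thesis using G by (intro exI[of _ "int x"]) (simp add: S_def mult_ac)
  qed
  have S_le: "int S \<le> 256 * \<bar>n\<bar> ^ 6"
  proof (cases "2 * \<bar>n\<bar> \<le> int S")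
    case True
    then have "int S \<le> 16 * \<bar>n\<bar> ^ 3 * (int u * int v)"
      using F(3) u(1) v(1) corner assms(1,2) by (intro gap_principle[of k]) fastforce+
    then have "(int S)\<^sup>2 \<le> (16 * \<bar>n\<bar> ^ 3 * (int u * int v))\<^sup>2" by (intro power_mono) auto
    also have "\<dots> = 256 * \<bar>n\<bar> ^ 6 * int ((u * v)\<^sup>2)"
      by (simp add: power_mult_distrib flip: power_mult)
    also have "\<dots> \<le> 256 * \<bar>n\<bar> ^ 6 * int S" using uvS by (rule mult_left_mono) simp
    finally have "int S * int S \<le> 256 * \<bar>n\<bar> ^ 6 * int S" by (simp add: power2_eq_square)
    moreover have "0 < int S" using True \<open>n \<noteq> 0\<close> by simp
    ultimately show ?thesis by (simp only: mult_le_cancel_right_pos)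
  next
    case False
    moreover have "\<bar>n\<bar> ^ 1 \<le> \<bar>n\<bar> ^ 6" using \<open>n \<noteq> 0\<close> by (intro power_increasing) auto
    ultimately show ?thesis by simp
  qed
  have "(int (a0 * \<Prod>F))\<^sup>2 = (int S)\<^sup>2 * int ((u * v)\<^sup>2)"
    by (simp add: prod S_def power_mult_distrib)
  also have "\<dots> \<le> (int S)\<^sup>2 * int S" using uvS by (rule mult_left_mono) simp
  also have "\<dots> = (int S) ^ 3" by (simp add: power2_eq_square power3_eq_cube)
  also have "\<dots> \<le> (256 * \<bar>n\<bar> ^ 6) ^ 3" using S_le by (intro power_mono) auto
  also have "\<dots> = (4096 * \<bar>n\<bar> ^ 9)\<^sup>2" by (simp add: power_mult_distrib flip: power_mult)
  finally show ?thesis by (rule power2_le_imp_le) simp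
qed

section \<open>Subgrids away from the singularity\<close>

lemma median_element:
  fixes A :: "'a::linorder set"
  assumes "finite A" "A \<noteq> {}"
  obtains m where "card A \<le> 2 * card {a\<in>A. a \<le> m}" "card A \<le> 2 * card {a\<in>A. m \<le> a}"
proof -
  define T where "T = {m\<in>A. card A \<le> 2 * card {a\<in>A. a \<le> m}}"
  have "{a\<in>A. a \<le> Max A} = A" using assms by auto
  then have "Max A \<in> T" using assms by (simp add: T_def)
  then have m: "Min T \<in> T" "\<And>x. x \<in> T \<Longrightarrow> Min T \<le> x"
    using \<open>finite A\<close> Min_in[of T] Min_le[of T] by (fastforce simp: T_def)+
  define m where "m = Min T"
  have "2 * card {a\<in>A. a < m} \<le> card A"
  proof (cases "{a\<in>A. a < m} = {}")
    case False
    define m' where "m' = Max {a\<in>A. a < m}"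
    have m': "m' \<in> A" "m' < m" using False assms Max_in[of "{a\<in>A. a < m}"] by (auto simp: m'_def)
    have "{a\<in>A. a < m} \<subseteq> {a\<in>A. a \<le> m'}" using assms by (auto simp: m'_def)
    then have "card {a\<in>A. a < m} \<le> card {a\<in>A. a \<le> m'}" using assms by (intro card_mono) auto
    moreover have "m' \<notin> T" using m(2)[of m'] m' by (auto simp: m_def)
    ultimately show ?thesis using m' by (simp add: T_def)
  next
    case True
    then show ?thesis by (simp only: card.empty)
  qed
  moreover have "card A = card {a\<in>A. a < m} + card {a\<in>A. m \<le> a}"
    using assms by (subst card_Un_disjoint[symmetric]) (auto intro: arg_cong[of _ _ card])
  ultimately have "card A \<le> 2 * card {a\<in>A. m \<le> a}" by linarith
  moreover have "card A \<le> 2 * card {a\<in>A. a \<le> m}" using m(1) by (simp add: T_def m_def)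
  ultimately show ?thesis using that by blast
qed

text \<open>
  The binomial series needs \<open>c * a * b\<close> to stay away from \<open>\<bar>n\<bar>\<close> by a factor \<open>2\<close>. For negative \<open>n\<close> the
  products already exceed \<open>\<bar>n\<bar>\<close>, and the factor \<open>c = e\<close> pushes them further. For positive \<open>n\<close> let \<open>l\<close>
  and \<open>m\<close> be medians of \<open>A\<close> and \<open>B\<close>: if \<open>l * m \<le> n / 2\<close>, the lower halves do; otherwise the upper
  halves do, multiplied by \<open>e \<ge> 4\<close>.
\<close>

lemma subgrid_away_from:
  fixes A B :: "nat set" and n :: int and e :: nat
  assumes AB: "finite A" "finite B" "A \<noteq> {}" "B \<noteq> {}" and e: "4 \<le> e" and "n \<noteq> 0"
    and pos: "\<And>a b. a \<in> A \<Longrightarrow> b \<in> B \<Longrightarrow> 0 < int (a * b) + n"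
  obtains c A' B' where "c \<in> {1, e}" "A' \<subseteq> A" "B' \<subseteq> B"
    "card A \<le> 2 * card A'" "card B \<le> 2 * card B'"
    "(\<forall>a\<in>A'. \<forall>b\<in>B'. 2 * \<bar>n\<bar> \<le> int (c * a * b)) \<or>
     (0 < n \<and> (\<forall>a\<in>A'. \<forall>b\<in>B'. 2 * int (c * a * b) \<le> n))"
proof (cases "n < 0")
  case True
  have "2 * \<bar>n\<bar> \<le> int (e * a * b)" if "a \<in> A" "b \<in> B" for a b
  proof -
    have "4 * (a * b) \<le> e * (a * b)" using e by (intro mult_right_mono) auto
    then have "4 * int (a * b) \<le> int (e * a * b)"
      by (metis mult.assoc of_nat_le_iff of_nat_mult of_nat_numeral)
    then show ?thesis using pos[OF that] True by linarith
  qed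
  then show ?thesis using that[of e A B] by auto
next
  case False
  then have n: "0 < n" using \<open>n \<noteq> 0\<close> by simp
  obtain l where l: "card A \<le> 2 * card {a\<in>A. a \<le> l}" "card A \<le> 2 * card {a\<in>A. l \<le> a}"
    using median_element[OF AB(1,3)] .
  obtain m where m: "card B \<le> 2 * card {b\<in>B. b \<le> m}" "card B \<le> 2 * card {b\<in>B. m \<le> b}"
    using median_element[OF AB(2,4)] .
  show ?thesis
  proof (cases "2 * int (l * m) \<le> n")
    case True
    have "2 * int (1 * a * b) \<le> n" if "a \<le> l" "b \<le> m" for a b
      using True mult_mono[OF that] by (simp flip: of_nat_mult)
    then show ?thesis using that[of 1 "{a\<in>A. a \<le> l}" "{b\<in>B. b \<le> m}"] l m n by auto
  next
    case False
    have "2 * \<bar>n\<bar> \<le> int (e * a * b)" if "l \<le> a" "m \<le> b" for a b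
    proof -
      have "4 * (l * m) \<le> e * (a * b)" using e that by (intro mult_mono) auto
      then have "4 * int (l * m) \<le> int (e * a * b)"
        by (metis mult.assoc of_nat_le_iff of_nat_mult of_nat_numeral)
      then show ?thesis using False n by linarith
    qed
    then show ?thesis using that[of e "{a\<in>A. l \<le> a}" "{b\<in>B. m \<le> b}"] l m by auto
  qed
qed

section \<open>The dimension of a cube\<close>

text \<open>
  Reserve the largest element \<open>e\<close> of \<open>F\<close>, and take the subset products of two disjoint \<open>r\<close>-element sets
  as the two sides \<open>A\<close> and \<open>B\<close> of the grid. Each side has at least \<open>r\<^sup>2 / 2\<close> elements, and the
  passage to a subgrid keeps at least half of them. All elements of the cube are at most
  \<open>4096 * \<bar>n\<bar> ^ 9 \<le> 2 ^ (12 + 9 * q)\<close>, so the grid bound reads \<open>r\<^sup>2 / 4 < 96 + 16 * (12 + 9 * q)\<close>.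
\<close>

lemma cube_dimension_le:
  fixes F :: "nat set" and a0 k q r :: nat and n :: int
  assumes "3 \<le> k" "n \<noteq> 0" "0 < a0" and F: "finite F" "6 \<le> card F" "\<And>x. x \<in> F \<Longrightarrow> 2 \<le> x"
    and cube: "\<And>G. G \<subseteq> F \<Longrightarrow> \<exists>x>0. int (a0 * \<Prod>G) + n = int x ^ k"
    and q: "\<bar>n\<bar> \<le> 2 ^ q" and r: "2 * r < card F"
  shows "r\<^sup>2 \<le> 1152 + 576 * q"
proof -
  define t where "t = 12 + 9 * q"
  define e where "e = Max F"
  have "F \<noteq> {}" using F by auto
  then have e: "e \<in> F" using F by (simp add: e_def)
  have "F \<subseteq> {2..e}" using F by (auto simp: e_def)
  then have "card F \<le> card {2..e}" by (intro card_mono) auto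
  then have e4: "4 \<le> e" using F(2) by simp
  have "2 * r \<le> card (F - {e})" using r e F(1) by simp
  then obtain E where E: "E \<subseteq> F - {e}" "card E = 2 * r" "finite E"
    using obtain_subset_with_card_n by metis
  then obtain F1 where F1: "F1 \<subseteq> E" "card F1 = r" "finite F1"
    using obtain_subset_with_card_n[of r E] by (metis le_add2 mult_2)
  define F2 where "F2 = E - F1"
  have F2: "card F2 = r" "finite F2" "F1 \<inter> F2 = {}" "F1 \<union> F2 \<subseteq> F - {e}"
    using E F1 by (auto simp: F2_def card_Diff_subset)
  have sub_F: "G \<subseteq> F" if "G \<subseteq> F1 \<or> G \<subseteq> F2" for G
    using that F2(4) by blast
  have prod_pos: "0 < \<Prod>G" if "G \<subseteq> F" for G
    using that F(3) by (intro prod_pos) fastforce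
  define A where "A = (\<lambda>G. a0 * \<Prod>G) ` Pow F1"
  define B where "B = (\<lambda>G. \<Prod>G) ` Pow F2"
  have AB: "finite A" "finite B" "A \<noteq> {}" "B \<noteq> {}" using F1 F2 by (auto simp: A_def B_def)
  have AB_pos: "\<And>a. a \<in> A \<Longrightarrow> 0 < a" "\<And>b. b \<in> B \<Longrightarrow> 0 < b"
    using prod_pos \<open>0 < a0\<close> sub_F by (auto simp: A_def B_def simp del: prod_zero_iff)
  have member: "\<exists>G\<subseteq>F. c * a * b = a0 * \<Prod>G" if c: "c \<in> {1, e}" and ab: "a \<in> A" "b \<in> B" for a b c
  proof -
    obtain G1 G2 where G: "G1 \<subseteq> F1" "G2 \<subseteq> F2" "a = a0 * \<Prod>G1" "b = \<Prod>G2"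
      using ab by (auto simp: A_def B_def)
    have un: "\<Prod>(G1 \<union> G2) = \<Prod>G1 * \<Prod>G2"
      using G F1 F2 by (intro prod.union_disjoint) (auto intro: finite_subset)
    have "e \<notin> G1 \<union> G2" "finite (G1 \<union> G2)" using G F1 F2 by (auto intro: finite_subset)
    then have "\<Prod>(insert e (G1 \<union> G2)) = e * (\<Prod>G1 * \<Prod>G2)" by (simp add: un)
    then have "c * a * b = a0 * \<Prod>(G1 \<union> G2) \<or> c * a * b = a0 * \<Prod>(insert e (G1 \<union> G2))"
      using c un G by auto
    moreover have "G1 \<union> G2 \<subseteq> F" "insert e (G1 \<union> G2) \<subseteq> F" using G F2(4) e by auto
    ultimately show ?thesis by blast
  qed
  have power: "\<exists>x>0. int (c * a * b) + n = int x ^ k" if "c \<in> {1, e}" "a \<in> A" "b \<in> B" for a b c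
    using member[OF that] cube by metis
  have size: "c * a * b \<le> 2 ^ t" if cab: "c \<in> {1, e}" "a \<in> A" "b \<in> B" for a b c
  proof -
    obtain G where G: "G \<subseteq> F" "c * a * b = a0 * \<Prod>G" using member[OF cab] by blast
    have "\<Prod>G \<le> \<Prod>F" using G F(1) prod_pos[of F] by (intro dvd_imp_le prod_dvd_prod_subset) auto
    then have "int (c * a * b) \<le> int (a0 * \<Prod>F)"
      unfolding G(2) of_nat_le_iff by (rule mult_le_mono2)
    also have "\<dots> \<le> 4096 * \<bar>n\<bar> ^ 9" using assms by (intro cube_product_le[of k]) auto
    also have "\<dots> \<le> 2 ^ 12 * (2 ^ q) ^ 9" using q by (intro mult_mono power_mono) auto
    also have "\<dots> = int (2 ^ t)" by (simp add: t_def power_add power_mult mult.commute[of 9])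
    finally show ?thesis by (simp only: of_nat_le_iff)
  qed
  have card_lower: "r\<^sup>2 \<le> 2 * card A" "r\<^sup>2 \<le> 2 * card B"
  proof -
    have "r * (r + 1) + 2 \<le> 2 * card ((\<lambda>G. \<Prod>G) ` Pow F1)"
      using card_subset_products[of F1] F1 F2 F(3) by auto
    moreover have "A = (\<lambda>x. a0 * x) ` ((\<lambda>G. \<Prod>G) ` Pow F1)" by (auto simp: A_def)
    then have "card A = card ((\<lambda>G. \<Prod>G) ` Pow F1)"
      using \<open>0 < a0\<close> by (simp only:) (intro card_image, auto simp: inj_on_def)
    ultimately show "r\<^sup>2 \<le> 2 * card A" by (simp add: power2_eq_square)
    have "r * (r + 1) + 2 \<le> 2 * card B"
      using card_subset_products[of F2] F2 F(3) by (auto simp: B_def)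
    then show "r\<^sup>2 \<le> 2 * card B" by (simp add: power2_eq_square)
  qed
  have "0 < int (a * b) + n" if "a \<in> A" "b \<in> B" for a b
    using power[of 1 a b] that by fastforce
  then obtain c A' B' where c: "c \<in> {1, e}" and sub: "A' \<subseteq> A" "B' \<subseteq> B"
    and half: "card A \<le> 2 * card A'" "card B \<le> 2 * card B'"
    and away: "(\<forall>a\<in>A'. \<forall>b\<in>B'. 2 * \<bar>n\<bar> \<le> int (c * a * b)) \<or>
     (0 < n \<and> (\<forall>a\<in>A'. \<forall>b\<in>B'. 2 * int (c * a * b) \<le> n))"
    using subgrid_away_from[OF AB e4 \<open>n \<noteq> 0\<close>] by blast
  have c_pos: "0 < c" using c e4 by auto
  have "card ((*) c ` A') < 96 + 16 * t \<or> card B' < 96 + 16 * t"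
  proof (rule kth_power_grid_small[of k n])
    show "\<exists>x>0. int (a * b) + n = int x ^ k" if "a \<in> (*) c ` A'" "b \<in> B'" for a b
      using that sub power[OF c] by blast
    show "a \<le> 2 ^ t" if a: "a \<in> (*) c ` A'" for a
    proof -
      obtain b where b: "b \<in> B" using AB by blast
      then have "a * 1 \<le> a * b" using AB_pos(2)[OF b] by (intro mult_left_mono) auto
      also have "\<dots> \<le> 2 ^ t" using a sub b size[OF c] by auto
      finally show ?thesis by simp
    qed
    show "b \<le> 2 ^ t" if b: "b \<in> B'" for b
    proof -
      obtain a where a: "a \<in> A" using AB by blast
      then have "1 * b \<le> c * a * b" using AB_pos(1)[OF a] c_pos by (intro mult_right_mono) auto
      also have "\<dots> \<le> 2 ^ t" using b sub a size[OF c] by auto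
      finally show ?thesis by simp
    qed
    have "(2::int) ^ q \<le> 2 ^ t" by (intro power_increasing) (auto simp: t_def)
    then show "\<bar>n\<bar> \<le> 2 ^ t" using q by linarith
    show "(\<forall>a\<in>(*) c ` A'. \<forall>b\<in>B'. 2 * \<bar>n\<bar> \<le> int (a * b)) \<or>
        (0 < n \<and> (\<forall>a\<in>(*) c ` A'. \<forall>b\<in>B'. 2 * int (a * b) \<le> n))"
      using away by blast
    show "finite ((*) c ` A')" "finite B'" using sub AB(1,2) finite_subset by blast+
    show "0 < a" if "a \<in> (*) c ` A'" for a using that sub(1) AB_pos(1) c_pos by fastforce
    show "0 < b" if "b \<in> B'" for b using that sub(2) AB_pos(2) by blast
  qed (use assms(1,2) in auto)
  moreover have "card ((*) c ` A') = card A'" using c_pos by (intro card_image) (auto simp: inj_on_def)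
  ultimately show ?thesis using half card_lower by (auto simp: t_def)
qed

theorem corollary1p7:
  "\<forall>k::nat. k \<ge> 3 \<longrightarrow>
     (\<exists>C::real. C > 0 \<and>
       (\<forall>n::int. n \<noteq> 0 \<longrightarrow>
         (\<forall>(d::nat) (a0::nat) (a::nat \<Rightarrow> nat).
            a0 > 0 \<longrightarrow>
            (\<forall>i\<in>{1..d}. a i > 0) \<longrightarrow>
            inj_on a {1..d} \<longrightarrow>
            int ` mult_hilbert_cube a0 a d \<subseteq> shifted_powers k n \<longrightarrow>
            real d \<le> C * sqrt (ln (real_of_int \<bar>n\<bar> + 1)))))"
proof (intro allI impI exI[of _ "420::real"] conjI)
  fix k :: nat and n :: int and d a0 :: nat and a :: "nat \<Rightarrow> nat"
  assume k: "3 \<le> k" and n: "n \<noteq> 0" and a0: "0 < a0" and pos: "\<forall>i\<in>{1..d}. 0 < a i"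
    and inj: "inj_on a {1..d}"
    and cube: "int ` mult_hilbert_cube a0 a d \<subseteq> shifted_powers k n"
  define N where "N = real_of_int \<bar>n\<bar> + 1"
  have N: "2 \<le> N" using n by (simp add: N_def)
  define q where "q = nat \<lceil>log 2 N\<rceil>"
  have log: "1 \<le> log 2 N" using N by simp
  have "N \<le> 2 powr real q"
    using N log by (subst log_le_iff[symmetric]) (auto simp: q_def)
  then have "real_of_int \<bar>n\<bar> \<le> real_of_int (2 ^ q)" by (simp add: N_def powr_realpow)
  then have q: "\<bar>n\<bar> \<le> 2 ^ q" by (simp only: of_int_le_iff)
  have q1: "1 \<le> q" "real q \<le> 2 * log 2 N" using log by (auto simp: q_def) linarith+
  have "d\<^sup>2 \<le> 43200 * q"
  proof (cases "d \<le> 9")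
    case True
    then have "d\<^sup>2 \<le> 9\<^sup>2" by (intro power_mono) auto
    then show ?thesis using q1 by simp
  next
    case False
    \<comment> \<open>The value \<open>1\<close> is discarded because it produces no new products.\<close>
    define F where "F = a ` {1..d} - {1}"
    define r where "r = (d - 2) div 2"
    have "card (a ` {1..d}) = d" using inj by (simp add: card_image)
    then have "d - 1 \<le> card F" using diff_card_le_card_Diff[of "{1}" "a ` {1..d}"] by (simp add: F_def)
    moreover have "finite F" by (simp add: F_def)
    moreover have "2 \<le> x" if "x \<in> F" for x
    proof -
      have "x \<noteq> 1" "0 < x" using that pos by (auto simp: F_def)
      then show ?thesis by simp
    qed
    moreover have "\<exists>x>0. int (a0 * \<Prod>G) + n = int x ^ k" if "G \<subseteq> F" for G
    proof -
      have "G \<subseteq> a ` {1..d}" using that by (auto simp: F_def)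
      then obtain I where I: "I \<subseteq> {1..d}" "G = a ` I" by (rule subset_imageE)
      then have "\<Prod>G = (\<Prod>i\<in>I. a i)"
        using prod.reindex[OF inj_on_subset[OF inj I(1)], of "\<lambda>x. x"] by (simp add: o_def)
      then have "a0 * \<Prod>G \<in> mult_hilbert_cube a0 a d" using I by (auto simp: mult_hilbert_cube_def)
      then have "int (a0 * \<Prod>G) \<in> shifted_powers k n" using cube by blast
      then show ?thesis by (auto simp: shifted_powers_def)
    qed
    ultimately have "r\<^sup>2 \<le> 1152 + 576 * q"
      using False by (intro cube_dimension_le[OF k n a0, where F = F] q) (auto simp: r_def)
    \<comment> \<open>Hence \<open>d\<^sup>2 \<le> 25 * r\<^sup>2\<close>, and \<open>25 * (1152 + 576 * q) \<le> 43200 * q\<close> as \<open>q \<ge> 1\<close>.\<close>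
    moreover have "d \<le> 5 * r" using False by (simp add: r_def)
    then have "d\<^sup>2 \<le> (5 * r)\<^sup>2" by (intro power_mono) auto
    ultimately show ?thesis using q1 by (simp add: power_mult_distrib)
  qed
  then have "real (d\<^sup>2) \<le> real (43200 * q)" by (simp only: of_nat_le_iff)
  also have "\<dots> \<le> 86400 * log 2 N" using q1 by simp
  also have "\<dots> \<le> 86400 * (2 * ln N)"
  proof -
    have "1 / 2 \<le> ln (2::real)" using ln_le_minus_one[of "1/2 :: real"] by (simp add: ln_div)
    then have "ln N * 1 \<le> ln N * (2 * ln 2)" using N by (intro mult_left_mono) auto
    then show ?thesis by (simp add: log_def field_simps)
  qed
  also have "\<dots> \<le> 420\<^sup>2 * ln N" using N by simp
  finally have "(real d)\<^sup>2 \<le> (420 * sqrt (ln N))\<^sup>2" using N by (simp add: power_mult_distrib)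
  moreover have "0 \<le> 420 * sqrt (ln N)" using N by simp
  ultimately show "real d \<le> 420 * sqrt (ln (real_of_int \<bar>n\<bar> + 1))"
    unfolding N_def by (rule power2_le_imp_le)
qed simp

end
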